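(* Let $(W,S)$ be a Coxeter system, $Q=(\sigma_1,\ldots,\sigma_n)$ a word of size $n$ in $S$, $\pi\in W$ an element contained in $Q$, and $\Delta=\Delta(Q,\pi)$ the subword complex. Let $k$ be a field. Then the Castelnuovo--Mumford regularity of the Stanley--Reisner ideal $I_\Delta\subseteq k[x_1,\ldots,x_n]$ satisfies $\mathrm{reg}(I_{\Delta})\le n-\ell(\pi)+1$.
   Context: A word $Q=(\sigma_1,\ldots,\sigma_n)$ of size $n$ is an ordered sequence of elements of the set $S$ of simple reflections. A subword $P$ of $Q$ is an ordered subsequence, identified with its set of positions in $[n]=\{1,\ldots,n\}$. $P$ represents $\pi$ if the ordered product of the simple reflections in $P$ is a reduced expression for $\pi$; $P$ contains $\pi$ if some subsequence of $P$ represents $\pi$. The subword complex $\Delta(Q,\pi)$ is the simplicial complex (on the $n$ positions of $Q$) of all subwords $Q\setminus P$ such that $P$ contains $\pi$. $\ell$ is the length function of $(W,S)$. $I_\Delta$ is generated by the square-free monomials $\prod_{i\in F}x_i$ over the non-faces $F\subseteq[n]$ of $\Delta$. The zero ideal is assigned regularity $-\infty$. *)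

theory Defs
  imports
    "HOL-Algebra.Multiplicative_Group"
    "HOL-Algebra.Generated_Groups"
    "HOL-Library.Poly_Mapping"
    "HOL-Library.Extended_Real"
    "Jordan_Normal_Form.Matrix"
begin

section \<open>Coxeter systems\<close>

definition word_prod :: "('a, 'b) monoid_scheme \<Rightarrow> 'a list \<Rightarrow> 'a" where
  "word_prod W ws = foldr (\<otimes>\<^bsub>W\<^esub>) ws \<one>\<^bsub>W\<^esub>"

text \<open>Insertion of a relator \<open>(st)^{m(s,t)}\<close> into a word, where \<open>m(s,t)\<close> is the order of \<open>st\<close>
  in \<open>W\<close>. The function \<^const>\<open>group.ord\<close> returns \<open>0\<close> for elements of infinite order; the relator
  is then the empty word, that is, there is no relation between \<open>s\<close> and \<open>t\<close>. For \<open>s = t\<close> the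
  relator is \<open>ss\<close>.\<close>

inductive relator_insertion :: "('a, 'b) monoid_scheme \<Rightarrow> 'a set \<Rightarrow> 'a list \<Rightarrow> 'a list \<Rightarrow> bool"
  for W S where
  "\<lbrakk>us \<in> lists S; vs \<in> lists S; s \<in> S; t \<in> S\<rbrakk> \<Longrightarrow>
    relator_insertion W S (us @ vs)
      (us @ concat (replicate (group.ord W (s \<otimes>\<^bsub>W\<^esub> t)) [s, t]) @ vs)"

text \<open>Since every generator is an involution, each group word in \<open>S\<close> can be written without
  inverses. So \<open>presentation\<close> says that \<open>W\<close> is the group with generators \<open>S\<close> and defining
  relations \<open>(st)^{m(s,t)} = 1\<close>.\<close>

locale coxeter_system = group W for W (structure) +
  fixes S :: "'a set"
  assumes simple_closed: "S \<subseteq> carrier W"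
    and simple_generate: "generate W S = carrier W"
    and simple_order: "s \<in> S \<Longrightarrow> ord s = 2"
    and presentation:
      "\<lbrakk>ws \<in> lists S; word_prod W ws = \<one>\<rbrakk> \<Longrightarrow> equivclp (relator_insertion W S) ws []"

definition coxeter_length :: "('a, 'b) monoid_scheme \<Rightarrow> 'a set \<Rightarrow> 'a \<Rightarrow> nat" where
  "coxeter_length W S w = (LEAST k. \<exists>ws \<in> lists S. length ws = k \<and> word_prod W ws = w)"

definition reduced_expression ::
    "('a, 'b) monoid_scheme \<Rightarrow> 'a set \<Rightarrow> 'a list \<Rightarrow> 'a \<Rightarrow> bool" where
  "reduced_expression W S ws w \<longleftrightarrow>
    ws \<in> lists S \<and> word_prod W ws = w \<and> length ws = coxeter_length W S w"


section \<open>Subword complexes\<close>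

text \<open>Positions in a word of size \<open>n\<close> (and likewise the variables \<open>x\<^sub>i\<close> below) are numbered
  \<open>0, \<dots>, n - 1\<close>. A subword of \<open>Q\<close> is a set \<open>P \<subseteq> {..<length Q}\<close> of positions; its list of
  letters is \<^term>\<open>nths Q P\<close>.\<close>

definition represents ::
    "('a, 'b) monoid_scheme \<Rightarrow> 'a set \<Rightarrow> 'a list \<Rightarrow> nat set \<Rightarrow> 'a \<Rightarrow> bool" where
  "represents W S Q P w \<longleftrightarrow> reduced_expression W S (nths Q P) w"

definition contains ::
    "('a, 'b) monoid_scheme \<Rightarrow> 'a set \<Rightarrow> 'a list \<Rightarrow> nat set \<Rightarrow> 'a \<Rightarrow> bool" where
  "contains W S Q P w \<longleftrightarrow> (\<exists>P' \<subseteq> P. represents W S Q P' w)"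

definition subword_complex ::
    "('a, 'b) monoid_scheme \<Rightarrow> 'a set \<Rightarrow> 'a list \<Rightarrow> 'a \<Rightarrow> nat set set" where
  "subword_complex W S Q w =
    {{..<length Q} - P | P. P \<subseteq> {..<length Q} \<and> contains W S Q P w}"


section \<open>The polynomial ring and Stanley--Reisner ideals\<close>

text \<open>Polynomials in the variables \<open>x\<^sub>0, x\<^sub>1, \<dots>\<close>: finitely supported functions from monomials
  (exponent vectors) to coefficients, with the convolution product of
  \<^theory>\<open>HOL-Library.Poly_Mapping\<close>.\<close>

type_synonym 'k mpoly = "(nat \<Rightarrow>\<^sub>0 nat) \<Rightarrow>\<^sub>0 'k"

definition polys :: "nat \<Rightarrow> 'k::field mpoly set" where
  "polys n = {p. \<forall>m \<in> Poly_Mapping.keys p. Poly_Mapping.keys m \<subseteq> {..<n}}"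

definition poly_ring :: "nat \<Rightarrow> 'k::field mpoly ring" where
  "poly_ring n = \<lparr>carrier = polys n, monoid.mult = (*), one = 1, zero = 0, add = (+)\<rparr>"

definition pvar :: "nat \<Rightarrow> 'k::field mpoly" where
  "pvar i = Poly_Mapping.single (Poly_Mapping.single i 1) 1"

definition stanley_reisner_ideal :: "nat \<Rightarrow> nat set set \<Rightarrow> 'k::field mpoly set" where
  "stanley_reisner_ideal n \<Delta> =
    genideal (poly_ring n) {\<Prod>i\<in>F. pvar i | F. F \<subseteq> {..<n} \<and> F \<notin> \<Delta>}"


section \<open>Graded free resolutions and regularity\<close>

definition total_degree :: "(nat \<Rightarrow>\<^sub>0 nat) \<Rightarrow> nat" where
  "total_degree m = (\<Sum>i \<in> Poly_Mapping.keys m. Poly_Mapping.lookup m i)"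

definition homogeneous :: "nat \<Rightarrow> int \<Rightarrow> 'k::field mpoly \<Rightarrow> bool" where
  "homogeneous n e p \<longleftrightarrow>
    p \<in> polys n \<and> (\<forall>m \<in> Poly_Mapping.keys p. int (total_degree m) = e)"

text \<open>Write \<open>R = k[x\<^sub>0, \<dots>, x\<^bsub>n-1\<^esub>]\<close>. A list \<open>a\<close> of integers stands for the graded free module
  \<open>\<Oplus>\<^sub>j R(-a\<^sub>j)\<close>, whose \<open>j\<close>-th basis element has degree \<open>a\<^sub>j\<close>. A homomorphism of degree \<open>0\<close> from
  \<open>\<Oplus>\<^sub>j R(-a\<^sub>j)\<close> to \<open>\<Oplus>\<^sub>i R(-b\<^sub>i)\<close> is a matrix whose \<open>(i,j)\<close> entry is homogeneous of degree
  \<open>a\<^sub>j - b\<^sub>i\<close>.\<close>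

definition free_module :: "nat \<Rightarrow> nat \<Rightarrow> 'k::field mpoly vec set" where
  "free_module n r = {v \<in> carrier_vec r. \<forall>i < r. v $ i \<in> polys n}"

definition graded_hom :: "nat \<Rightarrow> int list \<Rightarrow> int list \<Rightarrow> 'k::field mpoly mat \<Rightarrow> bool" where
  "graded_hom n a b A \<longleftrightarrow>
    A \<in> carrier_mat (length b) (length a) \<and>
    (\<forall>i < length b. \<forall>j < length a. homogeneous n (a ! j - b ! i) (A $$ (i, j)))"

definition hom_image :: "nat \<Rightarrow> 'k::field mpoly mat \<Rightarrow> 'k mpoly vec set" where
  "hom_image n A = (\<lambda>v. A *\<^sub>v v) ` free_module n (dim_col A)"

definition hom_kernel :: "nat \<Rightarrow> 'k::field mpoly mat \<Rightarrow> 'k mpoly vec set" where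
  "hom_kernel n A = {v \<in> free_module n (dim_col A). A *\<^sub>v v = 0\<^sub>v (dim_row A)}"

text \<open>A graded free resolution \<open>\<dots> \<rightarrow> F\<^sub>1 \<rightarrow> F\<^sub>0 \<rightarrow> I \<rightarrow> 0\<close> of a homogeneous ideal \<open>I\<close> of \<open>R\<close> by
  finitely generated modules: \<open>d i\<close> lists the degrees of the basis of \<open>F\<^sub>i\<close>, the matrix \<open>D 0\<close> is
  the augmentation \<open>F\<^sub>0 \<rightarrow> I \<subseteq> R\<close>, and \<open>D (i + 1)\<close> is the differential from \<open>F\<^bsub>i+1\<^esub>\<close> to \<open>F\<^sub>i\<close>.\<close>

definition graded_free_resolution ::
    "nat \<Rightarrow> 'k::field mpoly set \<Rightarrow> (nat \<Rightarrow> int list) \<Rightarrow> (nat \<Rightarrow> 'k mpoly mat) \<Rightarrow> bool" where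
  "graded_free_resolution n I d D \<longleftrightarrow>
    graded_hom n (d 0) [0] (D 0) \<and>
    (\<forall>i. graded_hom n (d (Suc i)) (d i) (D (Suc i))) \<and>
    hom_image n (D 0) = {vec 1 (\<lambda>_. f) | f. f \<in> I} \<and>
    (\<forall>i. hom_kernel n (D i) = hom_image n (D (Suc i)))"

text \<open>Minimality: the differential from \<open>F\<^bsub>i+1\<^esub>\<close> maps into \<open>\<mm>F\<^sub>i\<close>, where
  \<open>\<mm> = (x\<^sub>0, \<dots>, x\<^bsub>n-1\<^esub>)\<close>, i.e. its entries have no constant term.\<close>

definition minimal_graded_free_resolution ::
    "nat \<Rightarrow> 'k::field mpoly set \<Rightarrow> (nat \<Rightarrow> int list) \<Rightarrow> (nat \<Rightarrow> 'k mpoly mat) \<Rightarrow> bool" where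
  "minimal_graded_free_resolution n I d D \<longleftrightarrow>
    graded_free_resolution n I d D \<and>
    (\<forall>i. \<forall>A \<in> elements_mat (D (Suc i)). Poly_Mapping.lookup A 0 = 0)"

text \<open>The Castelnuovo--Mumford regularity
  \<open>sup {j - i | \<beta>\<^bsub>i,j\<^esub>(I) \<noteq> 0}\<close>, where the graded Betti number \<open>\<beta>\<^bsub>i,j\<^esub>(I)\<close> is the number of
  basis elements of degree \<open>j\<close> in step \<open>i\<close> of the minimal graded free resolution of \<open>I\<close>. Such a
  resolution exists for every homogeneous ideal and is unique up to isomorphism, so the
  bound variables \<open>d\<close> and \<open>D\<close> do not affect the value. The supremum is taken in the extended
  reals, so the zero ideal has regularity \<open>-\<infinity>\<close>.\<close>

definition regularity :: "nat \<Rightarrow> 'k::field mpoly set \<Rightarrow> ereal" where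
  "regularity n I =
    Sup {ereal (real_of_int j - real i) | i j.
          \<exists>d D. minimal_graded_free_resolution n I d D \<and> j \<in> set (d i)}"

end

theory Submission
  imports Defs
begin

text \<open>
  The faces of the subword complex are the complements of the subwords that contain \<open>\<pi>\<close>. Such a
  subword has at least \<open>\<ell>(\<pi>)\<close> letters, so a face has at most \<open>D = n - \<ell>(\<pi>)\<close> elements. The bound then
  follows from a fact about an arbitrary simplicial complex \<open>\<Delta>\<close>: if its faces have at most \<open>D\<close>
  elements, then \<open>reg I\<^sub>\<Delta> \<le> D + 1\<close>. One way to see this fact is Hochster's formula, by which
  \<open>\<beta>\<^bsub>i,j\<^esub>(I\<^sub>\<Delta>)\<close> is the sum of the dimensions of the reduced cohomology groups of degree
  \<open>j - i - 2\<close> of the restrictions of \<open>\<Delta>\<close> to \<open>j\<close> vertices; these vanish for \<open>j - i - 2 > D - 1\<close>,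
  since \<open>\<Delta>\<close> has dimension at most \<open>D - 1\<close>.

  The proof below makes the vanishing part of this argument explicit. Let \<open>K\<close> be the Koszul complex
  of the variables.

  First, \<open>K \<otimes> I\<^sub>\<Delta>\<close> is exact in homological degree \<open>i\<close> and internal degree \<open>j\<close> whenever
  \<open>j - i \<ge> D + 2\<close>. In each multidegree \<open>a \<noteq> 0\<close>, the complex \<open>K\<close> is the augmented simplicial chain
  complex of the simplex on the support of \<open>a\<close>, and coning off a vertex contracts it
  (\<open>koszul_cone_homotopy\<close>). If the vertex is one where \<open>a\<close> is maximal, then in this range
  of degrees the contraction preserves \<open>I\<^sub>\<Delta>\<close> (\<open>cone_nonface_polys\<close>): it either keeps the support of a
  monomial, or it produces a square-free monomial of degree greater than \<open>D\<close>, whose support is too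
  large to be a face.

  Second, if \<open>K \<otimes> I\<close> is exact at \<open>(i, j)\<close>, then a minimal resolution \<open>F\<close> of \<open>I\<close> has no generator of
  degree \<open>j\<close> in step \<open>i\<close> (\<open>degree_not_in_minimal_resolution\<close>). This is the balancing of \<open>Tor(I, k)\<close>,
  done as a chase in the double complex \<open>K \<otimes> F\<close> (\<open>koszul_chain_decomposition\<close>): it shows that a basis
  element of \<open>F\<^sub>i\<close> of degree \<open>j\<close> is the sum of a Koszul boundary and an element of the image of
  \<open>F\<^bsub>i+1\<^esub>\<close>, and both lie in \<open>\<mm>F\<^sub>i\<close>, which is absurd.
\<close>

section \<open>Polynomials: coefficients and homogeneity\<close>

abbreviation "coef \<equiv> Poly_Mapping.lookup"
abbreviation "supp \<equiv> Poly_Mapping.keys"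

lemma lookup_pvar_mult:
  "coef (pvar i * f) b =
    (if 0 < coef b i then coef f (b - Poly_Mapping.single i 1) else (0::'k::field))"
proof -
  define e :: "nat \<Rightarrow>\<^sub>0 nat" where "e = Poly_Mapping.single i 1"
  let ?g = "\<lambda>l. Sum_any (\<lambda>q. coef f q when b = l + q)"
  have "coef (pvar i * f) b = Sum_any (\<lambda>l. (1 when e = l) * ?g l)"
    unfolding pvar_def lookup_mult e_def lookup_single ..
  also have "(\<lambda>l. (1 when e = l) * ?g l) = (\<lambda>l. ?g l when l = e)"
    by (auto simp: when_def fun_eq_iff)
  also have "Sum_any (\<lambda>l. ?g l when l = e) = ?g e" by simp
  also have "\<dots> = (if 0 < coef b i then coef f (b - e) else 0)"
  proof (cases "0 < coef b i")
    case True
    then have "b = e + (b - e)"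
      by (intro poly_mapping_eqI) (auto simp: e_def lookup_add lookup_minus lookup_single when_def)
    then have "b = e + q \<longleftrightarrow> q = b - e" for q by (metis add_diff_cancel_left')
    with True show ?thesis by simp
  next
    case False
    then have "b \<noteq> e + q" for q
      by (auto simp: e_def lookup_add)
    with False show ?thesis by simp
  qed
  finally show ?thesis unfolding e_def .
qed

lemma keys_add_nat: "supp (a + b :: nat \<Rightarrow>\<^sub>0 nat) = supp a \<union> supp b"
  by (auto simp: in_keys_iff lookup_add)

lemma polys_zero: "0 \<in> polys n" and polys_one: "1 \<in> polys n"
  by (auto simp: polys_def)

lemma polys_add: "p \<in> polys n \<Longrightarrow> q \<in> polys n \<Longrightarrow> p + q \<in> polys n"
  unfolding polys_def using Poly_Mapping.keys_add[of p q] by blast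

lemma polys_uminus: "p \<in> polys n \<Longrightarrow> - p \<in> polys n"
  unfolding polys_def by (auto simp: in_keys_iff)

lemma polys_diff: "p \<in> polys n \<Longrightarrow> q \<in> polys n \<Longrightarrow> p - q \<in> polys n"
  using polys_add[OF _ polys_uminus, of p n q] by simp

lemma polys_mult: "p \<in> polys n \<Longrightarrow> q \<in> polys n \<Longrightarrow> p * q \<in> polys n"
  unfolding polys_def using keys_mult[of p q] by (fastforce simp: keys_add_nat)

lemma polys_sum: "(\<And>x. x \<in> A \<Longrightarrow> f x \<in> polys n) \<Longrightarrow> sum f A \<in> polys n"
  by (induction A rule: infinite_finite_induct) (auto simp: polys_zero polys_add)

lemma polys_pvar: "i < n \<Longrightarrow> pvar i \<in> polys n"
  by (simp add: polys_def pvar_def)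

lemma total_degree_eq_sum:
  "finite A \<Longrightarrow> supp m \<subseteq> A \<Longrightarrow> total_degree m = (\<Sum>i\<in>A. coef m i)"
  unfolding total_degree_def by (rule sum.mono_neutral_left) (auto simp: in_keys_iff)

lemma total_degree_add: "total_degree (a + b) = total_degree a + total_degree b"
proof -
  have "total_degree (a + b) = (\<Sum>i\<in>supp a \<union> supp b. coef (a + b) i)"
    by (rule total_degree_eq_sum) (auto simp: keys_add_nat)
  also have "\<dots> = (\<Sum>i\<in>supp a \<union> supp b. coef a i) + (\<Sum>i\<in>supp a \<union> supp b. coef b i)"
    by (simp add: lookup_add sum.distrib)
  also have "\<dots> = total_degree a + total_degree b"
    by (simp add: total_degree_eq_sum[of "supp a \<union> supp b"])
  finally show ?thesis .
qed

lemma total_degree_single: "total_degree (Poly_Mapping.single i 1) = 1"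
  by (simp add: total_degree_def)

lemma homogeneous_zero: "homogeneous n e 0"
  by (simp add: homogeneous_def polys_zero)

lemma homogeneous_add: "homogeneous n e p \<Longrightarrow> homogeneous n e q \<Longrightarrow> homogeneous n e (p + q)"
  unfolding homogeneous_def using Poly_Mapping.keys_add[of p q] by (auto intro: polys_add)

lemma homogeneous_sum: "(\<And>x. x \<in> A \<Longrightarrow> homogeneous n e (f x)) \<Longrightarrow> homogeneous n e (sum f A)"
  by (induction A rule: infinite_finite_induct) (auto simp: homogeneous_zero homogeneous_add)

lemma homogeneous_mult:
  assumes "homogeneous n e p" "homogeneous n e' q"
  shows "homogeneous n (e + e') (p * q)"
  unfolding homogeneous_def
proof (intro conjI ballI)
  show "p * q \<in> polys n" using assms by (auto simp: homogeneous_def intro: polys_mult)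
  fix m assume "m \<in> supp (p * q)"
  then obtain a b where "m = a + b" "a \<in> supp p" "b \<in> supp q" using keys_mult[of p q] by blast
  then show "int (total_degree m) = e + e'"
    using assms by (auto simp: homogeneous_def total_degree_add)
qed

section \<open>The Koszul complex and a contracting homotopy\<close>

definition indicator_monomial :: "nat set \<Rightarrow> (nat \<Rightarrow>\<^sub>0 nat)" where
  "indicator_monomial T = (\<Sum>i\<in>T. Poly_Mapping.single i 1)"

lemma lookup_indicator_monomial:
  "finite T \<Longrightarrow> coef (indicator_monomial T) i = (if i \<in> T then 1 else 0)"
  by (simp add: indicator_monomial_def lookup_sum lookup_single when_def)

lemma keys_indicator_monomial: "finite T \<Longrightarrow> supp (indicator_monomial T) = T"
  by (auto simp: in_keys_iff lookup_indicator_monomial split: if_splits)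

text \<open>The incidence sign of the vertex \<open>i\<close> in the simplex \<open>T \<union> {i}\<close>. The same value serves for \<open>T\<close> with
  and without \<open>i\<close>, because only the vertices below \<open>i\<close> are counted. The target ring is left open: the
  differential needs the sign as a polynomial, its coefficients need it in the field.\<close>

definition koszul_sign :: "nat \<Rightarrow> nat set \<Rightarrow> 'a::comm_ring_1" where
  "koszul_sign i T = (- 1) ^ card {t \<in> T. t < i}"

lemma koszul_sign_square: "koszul_sign i T * koszul_sign i T = 1"
  by (simp add: koszul_sign_def flip: power_add mult_2)

lemma koszul_sign_square_left: "koszul_sign i T * (koszul_sign i T * x) = x"
  by (simp add: koszul_sign_square flip: mult.assoc)

lemma koszul_sign_self [simp]:
  shows "koszul_sign i (T - {i}) = (koszul_sign i T :: 'a::comm_ring_1)"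
    and "koszul_sign i (insert i T) = (koszul_sign i T :: 'a)"
proof -
  have "{t \<in> T - {i}. t < i} = {t \<in> T. t < i}" "{t \<in> insert i T. t < i} = {t \<in> T. t < i}" by auto
  then show "koszul_sign i (T - {i}) = (koszul_sign i T :: 'a)"
    "koszul_sign i (insert i T) = (koszul_sign i T :: 'a)"
    unfolding koszul_sign_def by simp_all
qed

lemma koszul_sign_insert:
  assumes "finite T" "p \<notin> T"
  shows "koszul_sign i (insert p T) = (if p < i then - koszul_sign i T else koszul_sign i T)"
proof -
  have "{t \<in> insert p T. t < i} = (if p < i then insert p {t \<in> T. t < i} else {t \<in> T. t < i})"
    by auto
  then show ?thesis using assms by (simp add: koszul_sign_def)
qed

text \<open>Adding two vertices in the two possible orders gives opposite orientations; this is what makes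
  the Koszul differential square to zero.\<close>

lemma koszul_sign_swap:
  assumes "finite T" "i \<notin> T" "j \<notin> T" "i \<noteq> j"
  shows "koszul_sign i T * koszul_sign j (insert i T) =
    - (koszul_sign j T * koszul_sign i (insert j T))"
proof (cases "i < j")
  case True
  then have "\<not> j < i" by simp
  with True show ?thesis by (simp only: koszul_sign_insert assms if_True if_False
     mult_minus_right mult.commute not_False_eq_True)
next
  case False
  then have "j < i" using assms by simp
  with False show ?thesis by (simp only: koszul_sign_insert assms if_True if_False
     mult_minus_right mult.commute not_False_eq_True minus_minus)
qed

lemma lookup_koszul_sign_mult:
  "coef (koszul_sign i T * f) b = koszul_sign i T * coef f b"
proof -
  have "coef ((- 1) ^ k * f) b = (- 1) ^ k * coef f b" for k
    by (induction k) (simp_all add: lookup_uminus)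
  then show ?thesis unfolding koszul_sign_def .
qed

lemma keys_koszul_sign_mult: "supp (koszul_sign i T * f) = supp (f :: 'k::field mpoly)"
proof -
  have "koszul_sign i T \<noteq> (0 :: 'k)" by (simp add: koszul_sign_def)
  then show ?thesis by (simp add: set_eq_iff in_keys_iff lookup_koszul_sign_mult)
qed

text \<open>An element \<open>\<Sum>\<^sub>T \<omega> T \<cdot> e\<^sub>T\<close> of the Koszul complex is given by its coefficient function \<open>\<omega>\<close> on subsets
  of \<open>{..<n}\<close>. All homological degrees are treated together; degree \<open>p\<close> consists of the \<open>\<omega>\<close> that
  vanish unless \<open>card T = p\<close>. The coefficient of \<open>e\<^sub>T\<close> in the boundary collects the terms
  \<open>e\<^bsub>T \<union> {i}\<^esub> \<mapsto> \<plusminus> x\<^sub>i e\<^sub>T\<close>.\<close>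

definition koszul :: "nat \<Rightarrow> (nat set \<Rightarrow> 'k::field mpoly) \<Rightarrow> nat set \<Rightarrow> 'k mpoly" where
  "koszul n \<omega> T = (\<Sum>i\<in>{..<n} - T. koszul_sign i T * (pvar i * \<omega> (insert i T)))"

text \<open>The apex of the cone in multidegree \<open>a\<close>. Any vertex in the support of \<open>a\<close> would contract the Koszul
  complex of the polynomial ring; the choice of a largest exponent matters for monomial ideals: if
  the exponent of the pivot is \<open>1\<close>, then \<open>a\<close> is square-free.\<close>

definition pivot :: "(nat \<Rightarrow>\<^sub>0 nat) \<Rightarrow> nat" where
  "pivot a = (SOME p. p \<in> supp a \<and> (\<forall>q. coef a q \<le> coef a p))"

lemma pivot_max:
  assumes "a \<noteq> 0"
  shows "pivot a \<in> supp a" "coef a q \<le> coef a (pivot a)"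
proof -
  have ne: "coef a ` supp a \<noteq> {}" using assms by (simp)
  have "Max (coef a ` supp a) \<in> coef a ` supp a" by (rule Max_in) (use ne in auto)
  then obtain p where p: "p \<in> supp a" "coef a p = Max (coef a ` supp a)" by auto
  have "coef a q \<le> coef a p" for q
    by (cases "q \<in> supp a") (auto simp: p(2) in_keys_iff intro: Max_ge)
  with p have "\<exists>p. p \<in> supp a \<and> (\<forall>q. coef a q \<le> coef a p)" by blast
  from someI_ex[OF this] show "pivot a \<in> supp a" "coef a q \<le> coef a (pivot a)"
    unfolding pivot_def by auto
qed

text \<open>The monomial \<open>x\<^sup>b e\<^sub>T\<close> has multidegree \<open>b + 1\<^sub>T\<close>. With \<open>p\<close> the pivot of this multidegree, the
  contraction sends \<open>x\<^sup>m e\<^sub>U\<close> to \<open>\<plusminus> (x\<^sup>m / x\<^sub>p) e\<^bsub>U \<union> {p}\<^esub>\<close> if \<open>p \<notin> U\<close> and to \<open>0\<close> otherwise. The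
  definition reads off the coefficient of \<open>x\<^sup>b e\<^sub>T\<close> in the image of \<open>\<omega>\<close>; it comes from \<open>U = T - {p}\<close> and
  \<open>x\<^sup>m = x\<^sup>b x\<^sub>p\<close>, which has the same multidegree and hence the same pivot.\<close>

definition cone_coeff :: "(nat set \<Rightarrow> 'k::field mpoly) \<Rightarrow> nat set \<Rightarrow> (nat \<Rightarrow>\<^sub>0 nat) \<Rightarrow> 'k" where
  "cone_coeff \<omega> T b = (let p = pivot (b + indicator_monomial T) in
     if p \<in> T then koszul_sign p T * coef (\<omega> (T - {p})) (b + Poly_Mapping.single p 1) else 0)"

definition cone :: "(nat set \<Rightarrow> 'k::field mpoly) \<Rightarrow> nat set \<Rightarrow> 'k mpoly" where
  "cone \<omega> T = Abs_poly_mapping (cone_coeff \<omega> T)"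

lemma lookup_cone:
  assumes "finite T"
  shows "coef (cone \<omega> T) = cone_coeff \<omega> T"
proof -
  have "{b. cone_coeff \<omega> T b \<noteq> 0} \<subseteq>
      (\<Union>p\<in>T. (\<lambda>m. m - Poly_Mapping.single p 1) ` supp (\<omega> (T - {p})))" (is "_ \<subseteq> ?R")
  proof
    fix b assume "b \<in> {b. cone_coeff \<omega> T b \<noteq> 0}"
    then obtain p where "p \<in> T" "b + Poly_Mapping.single p 1 \<in> supp (\<omega> (T - {p}))"
      by (auto simp: cone_coeff_def Let_def in_keys_iff split: if_splits)
    moreover have "b = (b + Poly_Mapping.single p 1) - Poly_Mapping.single p 1" by simp
    ultimately show "b \<in> ?R" by blast
  qed
  then have "finite {b. cone_coeff \<omega> T b \<noteq> 0}"
    by (rule finite_subset) (use assms in auto)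
  then show ?thesis unfolding cone_def by simp
qed

lemma keys_coneE:
  assumes "finite T" "b \<in> supp (cone \<omega> T)"
  obtains p where "p = pivot (b + indicator_monomial T)" "p \<in> T"
    "b + Poly_Mapping.single p 1 \<in> supp (\<omega> (T - {p}))"
proof -
  define p where "p = pivot (b + indicator_monomial T)"
  have "cone_coeff \<omega> T b \<noteq> 0" using assms by (simp add: in_keys_iff lookup_cone)
  then have ne: "(if p \<in> T then koszul_sign p T *
      coef (\<omega> (T - {p})) (b + Poly_Mapping.single p 1) else 0) \<noteq> 0"
    unfolding cone_coeff_def Let_def p_def .
  have "p \<in> T"
  proof (rule ccontr)
    assume "p \<notin> T"
    with ne show False by simp
  qed
  moreover from ne this have "coef (\<omega> (T - {p})) (b + Poly_Mapping.single p 1) \<noteq> 0"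
    by (metis mult_zero_right)
  then have "b + Poly_Mapping.single p 1 \<in> supp (\<omega> (T - {p}))" unfolding in_keys_iff .
  ultimately show thesis using that[OF p_def] by blast
qed

lemma koszul_cong:
  assumes "\<And>U. U \<subseteq> {..<n} \<Longrightarrow> \<omega> U = \<omega>' U" "T \<subseteq> {..<n}"
  shows "koszul n \<omega> T = koszul n \<omega>' T"
  unfolding koszul_def using assms(2) by (intro sum.cong refl) (auto simp: assms(1))

lemma polys_koszul_sign_mult: "f \<in> polys n \<Longrightarrow> koszul_sign i T * f \<in> polys n"
  by (simp add: polys_def keys_koszul_sign_mult)

lemma polys_koszul:
  assumes "\<And>U. U \<subseteq> {..<n} \<Longrightarrow> \<omega> U \<in> polys n" "T \<subseteq> {..<n}"
  shows "koszul n \<omega> T \<in> polys n"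
  unfolding koszul_def using assms
  by (intro polys_sum polys_koszul_sign_mult polys_mult polys_pvar) auto

lemma koszul_const_coeff: "coef (koszul n \<omega> T) 0 = 0"
  by (simp add: koszul_def lookup_sum lookup_koszul_sign_mult lookup_pvar_mult)

lemma koszul_diff: "koszul n (\<lambda>U. \<omega> U - \<omega>' U) T = koszul n \<omega> T - koszul n \<omega>' T"
  by (simp add: koszul_def algebra_simps sum_subtractf)

text \<open>The differential is linear over the polynomial ring, so it commutes with every matrix.\<close>

lemma koszul_linear:
  "koszul n (\<lambda>U. \<Sum>c\<in>A. a c * \<omega> c U) T = (\<Sum>c\<in>A. a c * koszul n (\<omega> c) T)"
proof -
  have "koszul n (\<lambda>U. \<Sum>c\<in>A. a c * \<omega> c U) T =
    (\<Sum>i\<in>{..<n} - T. \<Sum>c\<in>A. a c * (koszul_sign i T * (pvar i * \<omega> c (insert i T))))"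
    by (simp add: koszul_def sum_distrib_left algebra_simps)
  also have "\<dots> = (\<Sum>c\<in>A. a c * koszul n (\<omega> c) T)"
    by (subst sum.swap) (simp add: koszul_def sum_distrib_left)
  finally show ?thesis .
qed

text \<open>The terms of the double boundary are indexed by ordered pairs of distinct vertices, and
  exchanging the two vertices changes the sign. The sum is split into \<open>i < j\<close> and \<open>j < i\<close>, since in
  characteristic \<open>2\<close> antisymmetry of the whole sum would say nothing.\<close>

lemma koszul_koszul:
  assumes "T \<subseteq> {..<n}"
  shows "koszul n (koszul n \<omega>) T = 0"
proof -
  define A where "A = {..<n} - T"
  define g where "g i j = koszul_sign i T * koszul_sign j (insert i T) *
    (pvar i * pvar j * \<omega> (insert i (insert j T)))" for i j
  have fin: "finite T" using assms finite_subset by blast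
  have [simp]: "finite A" by (simp add: A_def)
  have anti: "g i j = - g j i" if "i \<in> A" "j \<in> A" "i \<noteq> j" for i j
    using koszul_sign_swap[OF fin, of i j, where 'a="'a mpoly"] that
    by (simp add: g_def A_def insert_commute mult.commute mult.left_commute)
  have "koszul n (koszul n \<omega>) T = (\<Sum>i\<in>A. \<Sum>j\<in>A - {i}. g i j)"
  proof -
    have "{..<n} - insert i T = A - {i}" for i by (auto simp: A_def)
    then show ?thesis
      unfolding koszul_def A_def[symmetric]
      by (simp add: sum_distrib_left g_def algebra_simps insert_commute)
  qed
  also have "\<dots> = (\<Sum>i\<in>A. (\<Sum>j\<in>{j \<in> A. i < j}. g i j) + (\<Sum>j\<in>{j \<in> A. j < i}. g i j))"
  proof (rule sum.cong[OF refl])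
    fix i
    have split: "A - {i} = {j \<in> A. i < j} \<union> {j \<in> A. j < i}" by auto
    show "(\<Sum>j\<in>A - {i}. g i j) =
        (\<Sum>j\<in>{j \<in> A. i < j}. g i j) + (\<Sum>j\<in>{j \<in> A. j < i}. g i j)"
      unfolding split by (rule sum.union_disjoint) auto
  qed
  also have "\<dots> = (\<Sum>i\<in>A. \<Sum>j\<in>{j \<in> A. i < j}. g i j) + (\<Sum>i\<in>A. \<Sum>j\<in>{j \<in> A. j < i}. g i j)"
    by (rule sum.distrib)
  also have "(\<Sum>i\<in>A. \<Sum>j\<in>{j \<in> A. j < i}. g i j) = (\<Sum>j\<in>A. \<Sum>i\<in>{i \<in> A. j < i}. g i j)"
    by (rule sum.swap_restrict) auto
  also have "\<dots> = - (\<Sum>i\<in>A. \<Sum>j\<in>{j \<in> A. i < j}. g i j)"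
    unfolding sum_negf[symmetric] by (intro sum.cong refl anti) auto
  finally show ?thesis by simp
qed

text \<open>Both sides are compared in one multidegree \<open>a\<close> with pivot \<open>p\<close>. If \<open>p \<notin> T\<close>, then removing \<open>p\<close>
  from the cone over \<open>T\<close> is the one contribution. If \<open>p \<in> T\<close>, the term of the boundary that restores
  \<open>p\<close> gives \<open>\<omega> T\<close>, and all other terms cancel in pairs by the sign rule. The multidegree \<open>0\<close> has no
  pivot; it carries only the constants in homological degree \<open>0\<close>, which are not boundaries.\<close>

lemma koszul_cone_homotopy:
  assumes T: "T \<subseteq> {..<n}" and \<omega>: "\<And>U. U \<subseteq> {..<n} \<Longrightarrow> \<omega> U \<in> polys n"
    and const: "coef (\<omega> {}) 0 = 0"
  shows "koszul n (cone \<omega>) T + cone (koszul n \<omega>) T = \<omega> T"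
proof (rule poly_mapping_eqI)
  fix b
  have fin: "finite T" using T finite_subset by blast
  define a where "a = b + indicator_monomial T"
  define e :: "nat \<Rightarrow> nat \<Rightarrow>\<^sub>0 nat" where "e i = Poly_Mapping.single i 1" for i
  have a_lookup: "coef a i = coef b i + (if i \<in> T then 1 else 0)" for i
    by (simp add: a_def lookup_add lookup_indicator_monomial fin)
  define p where "p = pivot a"
  define g where "g i = koszul_sign i T *
     (if 0 < coef b i then cone_coeff \<omega> (insert i T) (b - e i) else 0)" for i
  \<comment> \<open>Adding the vertex \<open>i\<close> and dividing by \<open>x\<^sub>i\<close> keeps the multidegree, hence the pivot.\<close>
  have shift: "(b - e i) + indicator_monomial (insert i T) = a" if "0 < coef b i" "i \<notin> T" for i
    using that fin by (intro poly_mapping_eqI)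
      (auto simp: a_lookup e_def lookup_add lookup_minus lookup_single lookup_indicator_monomial
        when_def)
  have dh: "coef (koszul n (cone \<omega>) T) b = (\<Sum>i\<in>{..<n} - T. g i)"
    unfolding koszul_def lookup_sum
    by (rule sum.cong)
      (auto simp: g_def lookup_koszul_sign_mult lookup_pvar_mult lookup_cone fin e_def)
  have g_eq: "g i = (if 0 < coef b i \<and> p \<in> insert i T then koszul_sign i T *
      (koszul_sign p (insert i T) * coef (\<omega> (insert i T - {p})) (b - e i + e p)) else 0)"
    if "i \<notin> T" for i
    using shift[OF _ that] by (simp add: g_def cone_coeff_def Let_def e_def p_def)
  have hd: "coef (cone (koszul n \<omega>) T) b =
     (if p \<in> T then koszul_sign p T * coef (koszul n \<omega> (T - {p})) (b + e p) else 0)"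
    by (simp add: lookup_cone fin cone_coeff_def Let_def p_def a_def e_def)
  show "coef (koszul n (cone \<omega>) T + cone (koszul n \<omega>) T) b = coef (\<omega> T) b"
  proof (cases "p \<in> T")
    case pT: False
    have dh': "coef (koszul n (cone \<omega>) T) b = (\<Sum>i\<in>{..<n} - T. if i = p then g p else 0)"
      unfolding dh using pT by (intro sum.cong refl) (auto simp: g_eq)
    have hd0: "coef (cone (koszul n \<omega>) T) b = 0" using pT by (simp add: hd)
    show ?thesis
    proof (cases "p < n \<and> 0 < coef b p")
      case True
      then have "b - e p + e p = b"
        by (intro poly_mapping_eqI) (auto simp: e_def lookup_add lookup_minus lookup_single when_def)
      with True pT show ?thesis
        by (simp add: lookup_add hd0 dh' g_eq koszul_sign_square_left)
    next
      case False
      have "coef (\<omega> T) b = 0"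
      proof (cases "a = 0")
        case True
        then have "T = {}" "b = 0"
          using a_lookup by (auto simp: poly_mapping_eq_iff fun_eq_iff split: if_splits)
        then show ?thesis using const by simp
      next
        case a: False
        have "0 < coef b p"
          using pivot_max(1)[OF a] pT a_lookup[of p] by (simp add: p_def in_keys_iff)
        with False have "p \<in> supp b" "p \<notin> {..<n}" by (simp_all add: in_keys_iff)
        then have "b \<notin> supp (\<omega> T)" using \<omega>[OF T] unfolding polys_def by blast
        then show ?thesis by (simp add: in_keys_iff)
      qed
      then show ?thesis using False pT by (auto simp: lookup_add hd0 dh' g_eq)
    qed
  next
    case pT: True
    have pn: "p < n" using pT T by auto
    have shift': "b - e i + e p = b + e p - e i" if "0 < coef b i" for i
      using that by (intro poly_mapping_eqI)
        (auto simp: e_def lookup_add lookup_minus lookup_single when_def)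
    have ins: "insert p (T - {p}) = T" "insert p T = T" using pT by auto
    have dom: "{..<n} - (T - {p}) = insert p ({..<n} - T)" using pn pT by auto
    let ?f = "\<lambda>i. koszul_sign i (T - {p}) * (if 0 < coef (b + e p) i
        then coef (\<omega> (insert i (T - {p}))) (b + e p - e i) else 0)"
    have "coef (koszul n \<omega> (T - {p})) (b + e p) = ?f p + (\<Sum>i\<in>{..<n} - T. ?f i)"
      unfolding koszul_def lookup_sum lookup_koszul_sign_mult lookup_pvar_mult dom e_def
      using pT by (subst sum.insert) auto
    also have "?f p = koszul_sign p T * coef (\<omega> T) b"
      by (simp add: ins) (simp add: e_def lookup_add)
    finally have hd': "coef (cone (koszul n \<omega>) T) b =
        coef (\<omega> T) b + (\<Sum>i\<in>{..<n} - T. koszul_sign p T * ?f i)"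
      using pT by (simp add: hd distrib_left koszul_sign_square_left sum_distrib_left)
    have "koszul_sign p T * ?f i = - g i" if "i \<in> {..<n} - T" for i
    proof -
      have i: "i \<notin> T" "i \<noteq> p" using that pT by auto
      have set: "insert i T - {p} = insert i (T - {p})" using i by auto
      have sw: "koszul_sign p T * koszul_sign i (T - {p}) =
          - (koszul_sign i T * koszul_sign p (insert i T) :: 'a)"
        using koszul_sign_insert[of "T - {p}" p i, where 'a='a] i
          koszul_sign_insert[of T i p, where 'a='a] fin
        by (cases "p < i") (simp_all add: ins)
      have "coef (b + e p) i = coef b i"
        using i by (simp add: e_def lookup_add lookup_single)
      then show ?thesis
        using i pT sw by (simp add: g_eq shift' set[symmetric] mult.assoc[symmetric])
    qed
    then show ?thesis by (simp add: lookup_add dh hd' sum_negf)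
  qed
qed

lemma polys_cone:
  assumes "\<And>U. U \<subseteq> {..<n} \<Longrightarrow> \<omega> U \<in> polys n" "T \<subseteq> {..<n}"
  shows "cone \<omega> T \<in> polys n"
  unfolding polys_def
proof (intro CollectI ballI)
  fix b assume b: "b \<in> supp (cone \<omega> T)"
  have "finite T" using assms(2) finite_subset by blast
  then obtain p where "b + Poly_Mapping.single p 1 \<in> supp (\<omega> (T - {p}))"
    using keys_coneE[OF _ b] by metis
  moreover have "\<omega> (T - {p}) \<in> polys n" using assms by blast
  ultimately have "supp (b + Poly_Mapping.single p 1) \<subseteq> {..<n}" unfolding polys_def by blast
  then show "supp b \<subseteq> {..<n}" by (simp add: keys_add_nat)
qed

lemma homogeneous_cone:
  assumes "\<And>U. U \<subseteq> {..<n} \<Longrightarrow> homogeneous n e (\<omega> U)" "T \<subseteq> {..<n}"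
  shows "homogeneous n (e - 1) (cone \<omega> T)"
  unfolding homogeneous_def
proof (intro conjI ballI)
  show "cone \<omega> T \<in> polys n"
    using assms by (intro polys_cone) (auto simp: homogeneous_def)
  fix b assume b: "b \<in> supp (cone \<omega> T)"
  have "finite T" using assms(2) finite_subset by blast
  then obtain p where "b + Poly_Mapping.single p 1 \<in> supp (\<omega> (T - {p}))"
    using keys_coneE[OF _ b] by metis
  moreover have "homogeneous n e (\<omega> (T - {p}))" using assms by blast
  ultimately have "int (total_degree (b + Poly_Mapping.single p 1)) = e"
    unfolding homogeneous_def by blast
  then show "int (total_degree b) = e - 1"
    by (simp only: total_degree_add total_degree_single)
qed

lemma cone_eq_0:
  assumes "finite T" "\<And>p. p \<in> T \<Longrightarrow> \<omega> (T - {p}) = 0"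
  shows "cone \<omega> T = 0"
  by (rule poly_mapping_eqI) (simp add: lookup_cone assms cone_coeff_def Let_def)

section \<open>Stanley--Reisner ideals\<close>

text \<open>The Stanley--Reisner ideal as a span of monomials: membership can be read off the supports of the
  monomials that occur.\<close>

definition nonface_polys :: "nat \<Rightarrow> nat set set \<Rightarrow> 'k::field mpoly set" where
  "nonface_polys n \<Delta> = {f \<in> polys n. \<forall>m\<in>supp f. supp m \<notin> \<Delta>}"

lemma cring_poly_ring: "cring (poly_ring n :: 'k::field mpoly ring)"
proof (rule cringI)
  show "abelian_group (poly_ring n :: 'k mpoly ring)"
    by (rule abelian_groupI)
      (auto simp: poly_ring_def polys_add polys_zero add.assoc add.commute
        intro!: bexI[where x = "- x" for x] polys_uminus)
  show "comm_monoid (poly_ring n :: 'k mpoly ring)"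
    by (rule comm_monoidI) (auto simp: poly_ring_def polys_mult polys_one mult.assoc mult.commute)
qed (simp add: poly_ring_def distrib_right)

lemma poly_ring_a_inv:
  assumes "f \<in> polys n"
  shows "inv\<^bsub>add_monoid (poly_ring n)\<^esub> f = - (f :: 'k::field mpoly)"
proof -
  interpret cring "poly_ring n :: 'k mpoly ring" by (rule cring_poly_ring)
  have "\<ominus>\<^bsub>poly_ring n\<^esub> f = - f"
    by (rule minus_equality) (use assms in \<open>auto simp: poly_ring_def polys_uminus\<close>)
  then show ?thesis by (simp add: a_inv_def)
qed

lemma ideal_nonface_polys:
  assumes down: "\<And>F G. F \<in> \<Delta> \<Longrightarrow> G \<subseteq> F \<Longrightarrow> G \<in> \<Delta>"
  shows "ideal (nonface_polys n \<Delta> :: 'k::field mpoly set) (poly_ring n)"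
proof (rule idealI)
  have mult: "f * g \<in> nonface_polys n \<Delta>" if "f \<in> polys n" "g \<in> nonface_polys n \<Delta>"
    for f g :: "'k mpoly"
    unfolding nonface_polys_def
  proof (intro CollectI conjI ballI)
    show "f * g \<in> polys n" using that by (auto simp: nonface_polys_def polys_mult)
    fix m assume "m \<in> supp (f * g)"
    then obtain a b where "m = a + b" "b \<in> supp g" using keys_mult[of f g] by blast
    moreover from this have "supp b \<notin> \<Delta>" using that by (auto simp: nonface_polys_def)
    ultimately show "supp m \<notin> \<Delta>" using down[of "supp m" "supp b"] by (auto simp: keys_add_nat)
  qed
  show "ring (poly_ring n :: 'k mpoly ring)"
    using cring_poly_ring by (rule cring.axioms)
  show "subgroup (nonface_polys n \<Delta> :: 'k mpoly set) (add_monoid (poly_ring n))"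
  proof
    fix f g :: "'k mpoly"
    assume f: "f \<in> nonface_polys n \<Delta>"
    then show "inv\<^bsub>add_monoid (poly_ring n)\<^esub> f \<in> nonface_polys n \<Delta>"
      by (subst poly_ring_a_inv) (auto simp: nonface_polys_def polys_uminus)
    assume "g \<in> nonface_polys n \<Delta>"
    with f show "f \<otimes>\<^bsub>add_monoid (poly_ring n)\<^esub> g \<in> nonface_polys n \<Delta>"
      using Poly_Mapping.keys_add[of f g] by (auto simp: nonface_polys_def poly_ring_def polys_add)
  qed (auto simp: nonface_polys_def poly_ring_def polys_zero)
  fix f g :: "'k mpoly"
  assume "f \<in> nonface_polys n \<Delta>" "g \<in> carrier (poly_ring n)"
  then show "g \<otimes>\<^bsub>poly_ring n\<^esub> f \<in> nonface_polys n \<Delta>" "f \<otimes>\<^bsub>poly_ring n\<^esub> g \<in> nonface_polys n \<Delta>"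
    using mult[of g f] by (simp_all add: poly_ring_def mult.commute)
qed

lemma prod_pvar:
  "finite F \<Longrightarrow> (\<Prod>i\<in>F. pvar i) = Poly_Mapping.single (indicator_monomial F) (1 :: 'k::field)"
  by (induction F rule: finite_induct)
    (simp_all add: indicator_monomial_def pvar_def mult_single)

lemma poly_mapping_sum_singles: "f = (\<Sum>m\<in>supp f. Poly_Mapping.single m (coef f m))"
proof (rule poly_mapping_eqI)
  fix m
  have "coef (\<Sum>m\<in>supp f. Poly_Mapping.single m (coef f m)) m =
      (\<Sum>k\<in>supp f. if k = m then coef f m else 0)"
    unfolding lookup_sum lookup_single by (rule sum.cong) (auto simp: when_def)
  then show "coef f m = coef (\<Sum>m\<in>supp f. Poly_Mapping.single m (coef f m)) m"
    by (simp add: in_keys_iff)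
qed

text \<open>The span of the nonface monomials is an ideal because supersets of nonfaces are nonfaces, and a
  nonface monomial is a multiple of the generator that belongs to its support.\<close>

lemma stanley_reisner_ideal_eq_nonface_polys:
  assumes down: "\<And>F G. F \<in> \<Delta> \<Longrightarrow> G \<subseteq> F \<Longrightarrow> G \<in> \<Delta>"
  shows "stanley_reisner_ideal n \<Delta> = (nonface_polys n \<Delta> :: 'k::field mpoly set)"
proof
  interpret ring "poly_ring n :: 'k mpoly ring" using cring_poly_ring by (rule cring.axioms)
  let ?gens = "{\<Prod>i\<in>F. pvar i | F. F \<subseteq> {..<n} \<and> F \<notin> \<Delta>} :: 'k mpoly set"
  let ?I = "stanley_reisner_ideal n \<Delta> :: 'k mpoly set"
  have gens: "?gens \<subseteq> nonface_polys n \<Delta>"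
  proof
    fix f assume "f \<in> ?gens"
    then obtain F where F: "F \<subseteq> {..<n}" "F \<notin> \<Delta>" "f = (\<Prod>i\<in>F. pvar i)" by blast
    then have "finite F" using finite_subset by blast
    with F show "f \<in> nonface_polys n \<Delta>"
      by (simp add: nonface_polys_def polys_def prod_pvar keys_indicator_monomial)
  qed
  have "ideal (nonface_polys n \<Delta> :: 'k mpoly set) (poly_ring n)"
    by (rule ideal_nonface_polys) (rule down)
  then show "?I \<subseteq> nonface_polys n \<Delta>"
    unfolding stanley_reisner_ideal_def using gens by (rule genideal_minimal)
  have carr: "?gens \<subseteq> carrier (poly_ring n)"
    using gens by (auto simp: nonface_polys_def poly_ring_def)
  interpret I: ideal ?I "poly_ring n"
    unfolding stanley_reisner_ideal_def by (rule genideal_ideal[OF carr])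
  have add: "f + g \<in> ?I" if "f \<in> ?I" "g \<in> ?I" for f g
    using I.a_closed[OF that] by (simp add: poly_ring_def)
  have zero: "0 \<in> ?I" using I.zero_closed by (simp add: poly_ring_def)
  have sum: "sum h A \<in> ?I" if "\<And>x. x \<in> A \<Longrightarrow> h x \<in> ?I" for h and A :: "(nat \<Rightarrow>\<^sub>0 nat) set"
    using that by (induction A rule: infinite_finite_induct) (auto simp: zero add)
  show "nonface_polys n \<Delta> \<subseteq> ?I"
  proof
    fix f :: "'k mpoly" assume f: "f \<in> nonface_polys n \<Delta>"
    have "Poly_Mapping.single m (coef f m) \<in> ?I" if m: "m \<in> supp f" for m
    proof -
      have F: "supp m \<subseteq> {..<n}" "supp m \<notin> \<Delta>" using f m by (auto simp: nonface_polys_def polys_def)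
      then have gen: "(\<Prod>i\<in>supp m. pvar i) \<in> ?I"
        unfolding stanley_reisner_ideal_def using genideal_self[OF carr] by blast
      define m' where "m' = m - indicator_monomial (supp m)"
      have "m = m' + indicator_monomial (supp m)"
        by (rule poly_mapping_eqI)
          (auto simp: m'_def lookup_add lookup_minus lookup_indicator_monomial in_keys_iff)
      then have "Poly_Mapping.single m (coef f m) =
          Poly_Mapping.single m' (coef f m) * (\<Prod>i\<in>supp m. pvar i)"
        by (simp add: prod_pvar mult_single)
      moreover have "supp m' \<subseteq> supp m" by (auto simp: m'_def in_keys_iff lookup_minus)
      then have "Poly_Mapping.single m' (coef f m) \<in> carrier (poly_ring n)"
        using F by (auto simp: poly_ring_def polys_def)
      ultimately show ?thesis using I.I_l_closed[OF gen] by (simp add: poly_ring_def)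
    qed
    then show "f \<in> ?I" by (subst poly_mapping_sum_singles) (rule sum)
  qed
qed

text \<open>The contraction divides a monomial by the variable of the pivot \<open>p\<close>. If \<open>p\<close> survives in the
  quotient \<open>x\<^sup>b\<close>, the support is unchanged and stays a nonface. If it does not, then the multidegree is
  \<open>1\<close> at \<open>p\<close>, hence square-free by maximality, so \<open>x\<^sup>b\<close> is square-free of degree \<open>e - 1 > D\<close>.\<close>

lemma cone_nonface_polys:
  assumes card: "\<And>F. F \<in> \<Delta> \<Longrightarrow> card F \<le> D" and e: "int D + 2 \<le> e"
    and \<omega>: "\<And>U. U \<subseteq> {..<n} \<Longrightarrow> \<omega> U \<in> nonface_polys n \<Delta>"
    and hom: "\<And>U. U \<subseteq> {..<n} \<Longrightarrow> homogeneous n e (\<omega> U)" and T: "T \<subseteq> {..<n}"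
  shows "cone \<omega> T \<in> nonface_polys n \<Delta>"
  unfolding nonface_polys_def
proof (intro CollectI conjI ballI)
  have fin: "finite T" using T finite_subset by blast
  have hom': "homogeneous n (e - 1) (cone \<omega> T)" by (rule homogeneous_cone[OF hom T])
  then show "cone \<omega> T \<in> polys n" by (simp add: homogeneous_def)
  fix b assume b: "b \<in> supp (cone \<omega> T)"
  define a where "a = b + indicator_monomial T"
  obtain p where p: "p = pivot a" "p \<in> T"
    and bp: "b + Poly_Mapping.single p 1 \<in> supp (\<omega> (T - {p}))"
    using keys_coneE[OF fin b] unfolding a_def by metis
  have a_lookup: "coef a i = coef b i + (if i \<in> T then 1 else 0)" for i
    by (simp add: a_def lookup_add lookup_indicator_monomial fin)
  have a0: "a \<noteq> 0" using a_lookup[of p] p(2) by auto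
  show "supp b \<notin> \<Delta>"
  proof (cases "p \<in> supp b")
    case True
    then have "supp b = supp (b + Poly_Mapping.single p 1)" by (auto simp: keys_add_nat)
    moreover have "T - {p} \<subseteq> {..<n}" using T by blast
    then have "supp (b + Poly_Mapping.single p 1) \<notin> \<Delta>"
      using \<omega>[of "T - {p}"] bp by (auto simp: nonface_polys_def)
    ultimately show ?thesis by simp
  next
    case False
    then have "coef a p = 1" using a_lookup[of p] p(2) by (simp add: in_keys_iff)
    then have "coef b i \<le> 1" for i
      using pivot_max(2)[OF a0, of i] a_lookup[of i] p(1) by simp
    then have "total_degree b \<le> card (supp b)"
      unfolding total_degree_def using sum_bounded_above[of "supp b" "coef b" 1] by simp
    moreover have "int (total_degree b) = e - 1" using hom' b by (simp add: homogeneous_def)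
    ultimately show ?thesis using card[of "supp b"] e by linarith
  qed
qed

section \<open>Koszul chains with coefficients in a graded free module\<close>

text \<open>Elements of \<open>K \<otimes> R\<^sup>r\<close> are functions from sets to vectors of length \<open>r\<close>; an operator on \<open>K\<close> acts on
  each coordinate.\<close>

definition coordinatewise ::
    "nat \<Rightarrow> ((nat set \<Rightarrow> 'k::field mpoly) \<Rightarrow> nat set \<Rightarrow> 'k mpoly) \<Rightarrow>
      (nat set \<Rightarrow> 'k mpoly vec) \<Rightarrow> nat set \<Rightarrow> 'k mpoly vec" where
  "coordinatewise r \<Phi> y T = vec r (\<lambda>c. \<Phi> (\<lambda>U. y U $ c) T)"

lemma coordinatewise_simps [simp]:
  "dim_vec (coordinatewise r \<Phi> y T) = r"
  "c < r \<Longrightarrow> coordinatewise r \<Phi> y T $ c = \<Phi> (\<lambda>U. y U $ c) T"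
  "coordinatewise r \<Phi> y T \<in> carrier_vec r"
  by (simp_all add: coordinatewise_def)

text \<open>The elements of internal degree \<open>j\<close> in \<open>K\<^sub>p \<otimes> F\<close>, where \<open>F\<close> is the graded free module with basis
  degrees \<open>a\<close>. Since \<open>e\<^sub>T\<close> has degree \<open>card T = p\<close>, the coefficient at the \<open>c\<close>-th basis element is left
  with degree \<open>j - p - a\<^sub>c\<close>.\<close>

definition koszul_chain ::
    "nat \<Rightarrow> nat \<Rightarrow> int list \<Rightarrow> int \<Rightarrow> (nat set \<Rightarrow> 'k::field mpoly vec) \<Rightarrow> bool" where
  "koszul_chain n p a j y \<longleftrightarrow> (\<forall>T\<subseteq>{..<n}. y T \<in> carrier_vec (length a) \<and>
    (\<forall>c<length a. homogeneous n (j - int p - a ! c) (y T $ c)) \<and>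
    (card T \<noteq> p \<longrightarrow> y T = 0\<^sub>v (length a)))"

lemma koszul_chainD:
  assumes "koszul_chain n p a j y" "T \<subseteq> {..<n}"
  shows "y T \<in> carrier_vec (length a)"
    "c < length a \<Longrightarrow> homogeneous n (j - int p - a ! c) (y T $ c)"
    "card T \<noteq> p \<Longrightarrow> y T = 0\<^sub>v (length a)"
  using assms by (auto simp: koszul_chain_def)

lemma koszul_chain_free_module:
  "koszul_chain n p a j y \<Longrightarrow> T \<subseteq> {..<n} \<Longrightarrow> y T \<in> free_module n (length a)"
  by (auto simp: koszul_chain_def free_module_def homogeneous_def)

lemma mult_mat_vec_index_sum:
  "A \<in> carrier_mat r s \<Longrightarrow> v \<in> carrier_vec s \<Longrightarrow> i < r \<Longrightarrow>
    (A *\<^sub>v v) $ i = (\<Sum>c<s. A $$ (i, c) * v $ c)"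
  by (auto simp: scalar_prod_def atLeast0LessThan intro!: sum.cong)

lemma koszul_chain_mult_mat_vec:
  assumes A: "graded_hom n a b A" and y: "koszul_chain n p a j y"
  shows "koszul_chain n p b j (\<lambda>T. A *\<^sub>v y T)"
  unfolding koszul_chain_def
proof (intro allI impI conjI)
  have Ac: "A \<in> carrier_mat (length b) (length a)" using A by (simp add: graded_hom_def)
  fix T :: "nat set" assume T: "T \<subseteq> {..<n}"
  note yT = koszul_chainD[OF y T]
  show "A *\<^sub>v y T \<in> carrier_vec (length b)" using Ac yT(1) by simp
  show "A *\<^sub>v y T = 0\<^sub>v (length b)" if "card T \<noteq> p"
    using Ac yT(3)[OF that] by (intro eq_vecI) auto
  fix i assume i: "i < length b"
  have "homogeneous n (j - int p - b ! i) (A $$ (i, c) * y T $ c)" if c: "c < length a" for c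
  proof -
    have "homogeneous n (a ! c - b ! i) (A $$ (i, c))" using A i c by (simp add: graded_hom_def)
    from homogeneous_mult[OF this yT(2)[OF c]] show ?thesis by simp
  qed
  then show "homogeneous n (j - int p - b ! i) ((A *\<^sub>v y T) $ i)"
    unfolding mult_mat_vec_index_sum[OF Ac yT(1) i] by (intro homogeneous_sum) simp
qed

lemma koszul_chain_cone:
  assumes y: "koszul_chain n p a j y"
  shows "koszul_chain n (Suc p) a j (coordinatewise (length a) cone y)"
  unfolding koszul_chain_def
proof (intro allI impI conjI)
  fix T :: "nat set" assume T: "T \<subseteq> {..<n}"
  have fin: "finite T" using T finite_subset by blast
  show "coordinatewise (length a) cone y T \<in> carrier_vec (length a)" by simp
  show "homogeneous n (j - int (Suc p) - a ! c) (coordinatewise (length a) cone y T $ c)"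
    if c: "c < length a" for c
    using homogeneous_cone[of n "j - int p - a ! c" "\<lambda>U. y U $ c" T] koszul_chainD(2)[OF y _ c] T c
    by (simp add: algebra_simps)
  show "coordinatewise (length a) cone y T = 0\<^sub>v (length a)" if card: "card T \<noteq> Suc p"
  proof (rule eq_vecI)
    fix c assume "c < dim_vec (0\<^sub>v (length a))"
    then have c: "c < length a" by simp
    have "y (T - {q}) $ c = 0" if "q \<in> T" for q
    proof -
      have "card (T - {q}) \<noteq> p" using card_Suc_Diff1[OF fin that] card by simp
      moreover have "T - {q} \<subseteq> {..<n}" using T by blast
      ultimately show ?thesis using koszul_chainD(3)[OF y] c by simp
    qed
    then show "coordinatewise (length a) cone y T $ c = 0\<^sub>v (length a) $ c"
      using c by (simp add: cone_eq_0 fin)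
  qed simp
qed

lemma coordinatewise_koszul_mult_mat_vec:
  assumes A: "A \<in> carrier_mat r s" and y: "\<And>U. U \<subseteq> {..<n} \<Longrightarrow> y U \<in> carrier_vec s"
    and T: "T \<subseteq> {..<n}"
  shows "coordinatewise r (koszul n) (\<lambda>U. A *\<^sub>v y U) T = A *\<^sub>v coordinatewise s (koszul n) y T"
proof (rule eq_vecI)
  fix i assume "i < dim_vec (A *\<^sub>v coordinatewise s (koszul n) y T)"
  then have i: "i < r" using A by simp
  have "coordinatewise r (koszul n) (\<lambda>U. A *\<^sub>v y U) T $ i =
      koszul n (\<lambda>U. \<Sum>c<s. A $$ (i, c) * y U $ c) T"
    using i by (simp del: index_mult_mat_vec)
      (rule koszul_cong, auto simp: mult_mat_vec_index_sum[OF A y i] T simp del: index_mult_mat_vec)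
  also have "\<dots> = (\<Sum>c<s. A $$ (i, c) * koszul n (\<lambda>U. y U $ c) T)" by (rule koszul_linear)
  also have "\<dots> = (A *\<^sub>v coordinatewise s (koszul n) y T) $ i"
    by (subst mult_mat_vec_index_sum[OF A _ i]) simp_all
  finally show "coordinatewise r (koszul n) (\<lambda>U. A *\<^sub>v y U) T $ i =
      (A *\<^sub>v coordinatewise s (koszul n) y T) $ i" .
qed (use A in simp)

lemma coordinatewise_koszul_koszul:
  assumes "T \<subseteq> {..<n}"
  shows "coordinatewise r (koszul n) (coordinatewise r (koszul n) y) T = 0\<^sub>v r"
  by (rule eq_vecI) (simp_all add: koszul_koszul[OF assms])

lemma coordinatewise_koszul_diff:
  assumes "\<And>U. U \<subseteq> {..<n} \<Longrightarrow> y U \<in> carrier_vec r" "\<And>U. U \<subseteq> {..<n} \<Longrightarrow> y' U \<in> carrier_vec r"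
    and T: "T \<subseteq> {..<n}"
  shows "coordinatewise r (koszul n) (\<lambda>U. y U - y' U) T =
    coordinatewise r (koszul n) y T - coordinatewise r (koszul n) y' T"
proof (rule eq_vecI)
  fix c assume "c < dim_vec (coordinatewise r (koszul n) y T - coordinatewise r (koszul n) y' T)"
  then have c: "c < r" by simp
  have "koszul n (\<lambda>U. (y U - y' U) $ c) T = koszul n (\<lambda>U. y U $ c - y' U $ c) T"
  proof (rule koszul_cong[OF _ T])
    fix U :: "nat set" assume "U \<subseteq> {..<n}"
    from assms(2)[OF this] c show "(y U - y' U) $ c = y U $ c - y' U $ c" by simp
  qed
  then show "coordinatewise r (koszul n) (\<lambda>U. y U - y' U) T $ c =
      (coordinatewise r (koszul n) y T - coordinatewise r (koszul n) y' T) $ c"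
    using c by (simp add: koszul_diff)
qed simp

lemma coordinatewise_koszul_cong:
  assumes "\<And>U. U \<subseteq> {..<n} \<Longrightarrow> y U = y' U" "T \<subseteq> {..<n}"
  shows "coordinatewise r (koszul n) y T = coordinatewise r (koszul n) y' T"
  unfolding coordinatewise_def
  by (intro arg_cong[of _ _ "vec r"] ext koszul_cong[OF _ assms(2)]) (simp add: assms(1))

lemma coordinatewise_koszul_free_module:
  assumes "\<And>U. U \<subseteq> {..<n} \<Longrightarrow> y U \<in> free_module n r" "T \<subseteq> {..<n}"
  shows "coordinatewise r (koszul n) y T \<in> free_module n r"
  using assms by (auto simp: free_module_def intro!: polys_koszul)

lemma free_module_diff:
  "v \<in> free_module n r \<Longrightarrow> w \<in> free_module n r \<Longrightarrow> v - w \<in> free_module n r"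
  by (auto simp: free_module_def polys_diff)

lemma koszul_cone_cycle:
  assumes "T \<subseteq> {..<n}" "\<And>U. U \<subseteq> {..<n} \<Longrightarrow> \<omega> U \<in> polys n" "coef (\<omega> {}) 0 = 0"
    and "\<And>U. U \<subseteq> {..<n} \<Longrightarrow> koszul n \<omega> U = 0"
  shows "koszul n (cone \<omega>) T = \<omega> T"
proof -
  have "finite T" using assms(1) finite_subset by blast
  then have "cone (koszul n \<omega>) T = 0" using assms(1,4) by (intro cone_eq_0) blast+
  with koszul_cone_homotopy[of T n \<omega>, OF assms(1-3)] show ?thesis by simp
qed

lemma coordinatewise_koszul_cone_cycle:
  assumes T: "T \<subseteq> {..<n}" and y: "\<And>U. U \<subseteq> {..<n} \<Longrightarrow> y U \<in> free_module n r"
    and const: "\<And>c. c < r \<Longrightarrow> coef (y {} $ c) 0 = 0"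
    and cycle: "\<And>U. U \<subseteq> {..<n} \<Longrightarrow> coordinatewise r (koszul n) y U = 0\<^sub>v r"
  shows "coordinatewise r (koszul n) (coordinatewise r cone y) T = y T"
proof (rule eq_vecI)
  show "dim_vec (coordinatewise r (koszul n) (coordinatewise r cone y) T) = dim_vec (y T)"
    using y[OF T] by (auto simp: free_module_def)
  fix c assume "c < dim_vec (y T)"
  then have c: "c < r" using y[OF T] by (auto simp: free_module_def)
  have "koszul n (\<lambda>V. y V $ c) U = 0" if "U \<subseteq> {..<n}" for U
    using arg_cong[OF cycle[OF that], of "\<lambda>v. v $ c"] c by simp
  then have "koszul n (cone (\<lambda>V. y V $ c)) T = y T $ c"
    using y const c by (intro koszul_cone_cycle[OF T]) (auto simp: free_module_def)
  then show "coordinatewise r (koszul n) (coordinatewise r cone y) T $ c = y T $ c"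
    using c by simp
qed

section \<open>Betti numbers and Koszul homology\<close>

text \<open>Exactness of \<open>K \<otimes> I\<close> in homological degree \<open>i\<close> and internal degree \<open>j\<close>. The chain \<open>\<eta>\<close> is not asked
  to be homogeneous: over a homogeneous ideal, its component in the right degree would do as well.\<close>

definition koszul_homology_vanishes ::
    "nat \<Rightarrow> 'k::field mpoly set \<Rightarrow> nat \<Rightarrow> int \<Rightarrow> bool" where
  "koszul_homology_vanishes n I i j \<longleftrightarrow> (\<forall>\<omega>.
    (\<forall>U\<subseteq>{..<n}. \<omega> U \<in> I \<and> homogeneous n (j - int i) (\<omega> U) \<and> (card U \<noteq> i \<longrightarrow> \<omega> U = 0) \<and>
      koszul n \<omega> U = 0) \<longrightarrow>
    (\<exists>\<eta>. \<forall>U\<subseteq>{..<n}. \<eta> U \<in> I \<and> koszul n \<eta> U = \<omega> U))"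

locale graded_resolution =
  fixes n :: nat and I :: "'k::field mpoly set" and d :: "nat \<Rightarrow> int list"
    and D :: "nat \<Rightarrow> 'k mpoly mat"
  assumes resolution: "graded_free_resolution n I d D"
begin

text \<open>The degrees of the codomain of \<open>D k\<close>. With \<open>F\<^bsub>-1\<^esub> = R\<close> the augmentation becomes one more
  differential.\<close>

definition target :: "nat \<Rightarrow> int list" where
  "target k = (case k of 0 \<Rightarrow> [0] | Suc l \<Rightarrow> d l)"

lemma target_simps [simp]: "target 0 = [0]" "target (Suc l) = d l"
  by (simp_all add: target_def)

lemma graded_hom_differential: "graded_hom n (d k) (target k) (D k)"
  using resolution by (cases k) (auto simp: graded_free_resolution_def)

lemma differential_carrier: "D k \<in> carrier_mat (length (target k)) (length (d k))"
  using graded_hom_differential[of k] by (simp add: graded_hom_def)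

lemma kernel_eq_image: "hom_kernel n (D k) = hom_image n (D (Suc k))"
  using resolution by (simp add: graded_free_resolution_def)

lemma cycle_lift:
  assumes "v \<in> free_module n (length (d k))" "D k *\<^sub>v v = 0\<^sub>v (length (target k))"
  obtains u where "u \<in> free_module n (length (d (Suc k)))" "v = D (Suc k) *\<^sub>v u"
proof -
  have "v \<in> hom_kernel n (D k)"
    using assms differential_carrier[of k] by (simp add: hom_kernel_def)
  then have "v \<in> hom_image n (D (Suc k))" by (simp add: kernel_eq_image)
  then show thesis using that differential_carrier[of "Suc k"] by (auto simp: hom_image_def)
qed

lemma differential_square:
  assumes "u \<in> free_module n (length (d (Suc k)))"
  shows "D k *\<^sub>v (D (Suc k) *\<^sub>v u) = 0\<^sub>v (length (target k))"
proof -
  have "D (Suc k) *\<^sub>v u \<in> hom_kernel n (D k)"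
    unfolding kernel_eq_image hom_image_def using assms differential_carrier[of "Suc k"] by auto
  then show ?thesis using differential_carrier[of k] by (simp add: hom_kernel_def)
qed

lemma augmentation_in_ideal:
  assumes "v \<in> free_module n (length (d 0))"
  shows "(D 0 *\<^sub>v v) $ 0 \<in> I"
proof -
  have "D 0 *\<^sub>v v \<in> hom_image n (D 0)"
    using assms differential_carrier[of 0] by (auto simp: hom_image_def)
  then show ?thesis using resolution by (auto simp: graded_free_resolution_def)
qed

lemma ideal_lift:
  assumes "f \<in> I"
  obtains v where "v \<in> free_module n (length (d 0))" "D 0 *\<^sub>v v = vec 1 (\<lambda>_. f)"
proof -
  have "vec 1 (\<lambda>_. f) \<in> hom_image n (D 0)"
    using assms resolution by (auto simp: graded_free_resolution_def)
  then show thesis using that differential_carrier[of 0] by (auto simp: hom_image_def)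
qed

abbreviation koszul_differential ::
    "nat \<Rightarrow> (nat set \<Rightarrow> 'k mpoly vec) \<Rightarrow> nat set \<Rightarrow> 'k mpoly vec" where
  "koszul_differential k \<equiv> coordinatewise (length (d k)) (koszul n)"

text \<open>The common last step of the chase: \<open>y\<close> and the Koszul boundary of \<open>v\<close> have the same image under
  the differential of \<open>F\<close>, so by exactness of the resolution they differ by the image of some \<open>u\<close>.\<close>

lemma split_of_boundary_lift:
  assumes y: "\<And>U. U \<subseteq> {..<n} \<Longrightarrow> y U \<in> free_module n (length (d q))"
    and v: "\<And>U. U \<subseteq> {..<n} \<Longrightarrow> v U \<in> free_module n (length (d q))"
    and eq: "\<And>U. U \<subseteq> {..<n} \<Longrightarrow> D q *\<^sub>v y U = D q *\<^sub>v koszul_differential q v U"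
  shows "\<exists>u. (\<forall>T\<subseteq>{..<n}. u T \<in> free_module n (length (d (Suc q))) \<and>
    y T = koszul_differential q v T + D (Suc q) *\<^sub>v u T)"
proof -
  have "\<exists>u. u \<in> free_module n (length (d (Suc q))) \<and>
      y T = koszul_differential q v T + D (Suc q) *\<^sub>v u" if T: "T \<subseteq> {..<n}" for T
  proof -
    let ?w = "koszul_differential q v T"
    have w: "?w \<in> free_module n (length (d q))"
      by (rule coordinatewise_koszul_free_module[OF v T])
    have carr: "y T \<in> carrier_vec (length (d q))" "?w \<in> carrier_vec (length (d q))"
      using y[OF T] by (simp_all add: free_module_def)
    have "D q *\<^sub>v (y T - ?w) = D q *\<^sub>v y T - D q *\<^sub>v ?w"
      by (rule mult_minus_distrib_mat_vec[OF differential_carrier carr])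
    also have "\<dots> = 0\<^sub>v (length (target q))"
      using differential_carrier[of q] carr by (simp add: eq[OF T])
    finally obtain u where u: "u \<in> free_module n (length (d (Suc q)))" "y T - ?w = D (Suc q) *\<^sub>v u"
      using cycle_lift free_module_diff[OF y[OF T] w] by blast
    have "y T = ?w + (y T - ?w)" using carr by (intro eq_vecI) auto
    with u show ?thesis by auto
  qed
  then show ?thesis by metis
qed

text \<open>The chase in the double complex \<open>K \<otimes> F\<close>, with Koszul differential \<open>\<partial>\<close> and resolution differential
  \<open>D\<close>, along the antidiagonal \<open>p + q = i\<close>: a chain \<open>y\<close> in \<open>K\<^sub>p \<otimes> F\<^sub>q\<close> with \<open>D \<partial> y = 0\<close> is a sum
  \<open>\<partial> v + D u\<close>.

  For \<open>q = 0\<close>, the chain \<open>D y\<close> is a Koszul cycle with coefficients in \<open>I\<close>, hence by assumption the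
  boundary of a chain with coefficients in \<open>I\<close>, which lifts to \<open>F\<^sub>0\<close>. For \<open>q > 0\<close>, the cycle \<open>D y\<close> is the
  boundary of the chain \<open>y' = cone (D y)\<close> in \<open>K\<^bsub>p+1\<^esub> \<otimes> F\<^bsub>q-1\<^esub>\<close>, and \<open>D \<partial> y' = D D y = 0\<close>. By induction
  \<open>y' = \<partial> v' + D u'\<close>, whence \<open>D y = \<partial> y' = \<partial> D u' = D \<partial> u'\<close>. In both cases \<open>y\<close> and a Koszul boundary have
  the same image under \<open>D\<close>.

  The hypothesis on constant coefficients makes \<open>cone\<close> applicable to \<open>D y\<close>. In the induction it is
  automatic, since \<open>y'\<close> lives in positive homological degree and so vanishes at \<open>{}\<close>.\<close>

lemma koszul_chain_decomposition:
  assumes vanish: "koszul_homology_vanishes n I i j"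
    and y: "koszul_chain n p (d q) j y" and i: "p + q = i"
    and cycle: "\<And>U. U \<subseteq> {..<n} \<Longrightarrow> D q *\<^sub>v koszul_differential q y U = 0\<^sub>v (length (target q))"
    and const: "\<And>l c. q = Suc l \<Longrightarrow> c < length (d l) \<Longrightarrow> coef ((D q *\<^sub>v y {}) $ c) 0 = 0"
  shows "\<exists>v u. \<forall>T\<subseteq>{..<n}. v T \<in> free_module n (length (d q)) \<and>
    u T \<in> free_module n (length (d (Suc q))) \<and>
    y T = koszul_differential q v T + D (Suc q) *\<^sub>v u T"
  using y i cycle const
proof (induction q arbitrary: p y)
  case 0
  note y = \<open>koszul_chain n p (d 0) j y\<close>
  have yc: "y U \<in> carrier_vec (length (d 0))" if "U \<subseteq> {..<n}" for U
    using koszul_chainD(1)[OF y that] .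
  have D0: "D 0 \<in> carrier_mat 1 (length (d 0))" using differential_carrier[of 0] by simp
  define \<omega> where "\<omega> U = (D 0 *\<^sub>v y U) $ 0" for U
  have z: "koszul_chain n i [0] j (\<lambda>U. D 0 *\<^sub>v y U)"
    using koszul_chain_mult_mat_vec[OF graded_hom_differential y] \<open>p + 0 = i\<close> by simp
  have "\<exists>\<eta>. \<forall>U\<subseteq>{..<n}. \<eta> U \<in> I \<and> koszul n \<eta> U = \<omega> U"
  proof (rule vanish[unfolded koszul_homology_vanishes_def, rule_format], intro conjI impI)
    fix U :: "nat set" assume U: "U \<subseteq> {..<n}"
    show "\<omega> U \<in> I"
      unfolding \<omega>_def by (rule augmentation_in_ideal[OF koszul_chain_free_module[OF y U]])
    show "homogeneous n (j - int i) (\<omega> U)"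
      using koszul_chainD(2)[OF z U, of 0] by (simp add: \<omega>_def)
    show "\<omega> U = 0" if "card U \<noteq> i"
      using koszul_chainD(3)[OF z U that] by (simp add: \<omega>_def)
    have "koszul n \<omega> U = coordinatewise 1 (koszul n) (\<lambda>U. D 0 *\<^sub>v y U) U $ 0"
      unfolding \<omega>_def by (simp del: index_mult_mat_vec)
    also have "\<dots> = (D 0 *\<^sub>v koszul_differential 0 y U) $ 0"
      by (simp only: coordinatewise_koszul_mult_mat_vec[OF D0 yc U])
    also have "\<dots> = 0" using "0.prems"(3)[OF U] by simp
    finally show "koszul n \<omega> U = 0" .
  qed
  then obtain \<eta> where \<eta>: "\<And>U. U \<subseteq> {..<n} \<Longrightarrow> \<eta> U \<in> I"
    "\<And>U. U \<subseteq> {..<n} \<Longrightarrow> koszul n \<eta> U = \<omega> U" by blast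
  have "\<exists>v. v \<in> free_module n (length (d 0)) \<and> D 0 *\<^sub>v v = vec 1 (\<lambda>_. \<eta> U)"
    if "U \<subseteq> {..<n}" for U
    using ideal_lift[OF \<eta>(1)[OF that]] by blast
  then obtain v where v: "\<And>U. U \<subseteq> {..<n} \<Longrightarrow> v U \<in> free_module n (length (d 0))"
    "\<And>U. U \<subseteq> {..<n} \<Longrightarrow> D 0 *\<^sub>v v U = vec 1 (\<lambda>_. \<eta> U)" by metis
  have vc: "v U \<in> carrier_vec (length (d 0))" if "U \<subseteq> {..<n}" for U
    using v(1)[OF that] by (simp add: free_module_def)
  have "D 0 *\<^sub>v y T = D 0 *\<^sub>v koszul_differential 0 v T" if T: "T \<subseteq> {..<n}" for T
  proof -
    have "D 0 *\<^sub>v koszul_differential 0 v T = coordinatewise 1 (koszul n) (\<lambda>U. D 0 *\<^sub>v v U) T"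
      by (rule coordinatewise_koszul_mult_mat_vec[OF D0 vc T, symmetric])
    also have "\<dots> = coordinatewise 1 (koszul n) (\<lambda>U. vec 1 (\<lambda>_. \<eta> U)) T"
      by (rule coordinatewise_koszul_cong[OF v(2) T])
    also have "\<dots> = D 0 *\<^sub>v y T"
      by (rule eq_vecI) (use D0 \<eta>(2)[OF T] in \<open>simp_all add: \<omega>_def del: index_mult_mat_vec\<close>)
    finally show ?thesis ..
  qed
  from split_of_boundary_lift[OF koszul_chain_free_module[OF y] v(1) this] v(1)
  show ?case by blast
next
  case (Suc q)
  note y = \<open>koszul_chain n p (d (Suc q)) j y\<close>
  let ?r = "length (d q)"
  have yc: "y U \<in> carrier_vec (length (d (Suc q)))" if "U \<subseteq> {..<n}" for U
    using koszul_chainD(1)[OF y that] .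
  have DS: "D (Suc q) \<in> carrier_mat ?r (length (d (Suc q)))"
    using differential_carrier[of "Suc q"] by simp
  define z where "z U = D (Suc q) *\<^sub>v y U" for U
  have z: "koszul_chain n p (d q) j z"
    using koszul_chain_mult_mat_vec[OF graded_hom_differential y] unfolding z_def by simp
  define y' where "y' = coordinatewise ?r cone z"
  have y': "koszul_chain n (Suc p) (d q) j y'"
    unfolding y'_def by (rule koszul_chain_cone[OF z])
  have dy': "koszul_differential q y' T = z T" if T: "T \<subseteq> {..<n}" for T
    unfolding y'_def
  proof (rule coordinatewise_koszul_cone_cycle[OF T koszul_chain_free_module[OF z]])
    show "coef (z {} $ c) 0 = 0" if "c < ?r" for c
      unfolding z_def by (rule Suc.prems(4)[OF refl that])
    show "koszul_differential q z U = 0\<^sub>v ?r" if U: "U \<subseteq> {..<n}" for U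
      using coordinatewise_koszul_mult_mat_vec[OF DS yc U] Suc.prems(3)[OF U]
      unfolding z_def by simp
  qed
  have "\<exists>v u. \<forall>T\<subseteq>{..<n}. v T \<in> free_module n ?r \<and>
    u T \<in> free_module n (length (d (Suc q))) \<and>
    y' T = koszul_differential q v T + D (Suc q) *\<^sub>v u T"
  proof (rule Suc.IH[OF y'])
    show "Suc p + q = i" using Suc.prems(2) by simp
    show "D q *\<^sub>v koszul_differential q y' U = 0\<^sub>v (length (target q))" if U: "U \<subseteq> {..<n}" for U
      unfolding dy'[OF U] z_def
      by (rule differential_square[OF koszul_chain_free_module[OF y U]])
    fix l c assume l: "q = Suc l" "c < length (d l)"
    have "y' {} = 0\<^sub>v ?r" by (rule koszul_chainD(3)[OF y']) simp_all
    then show "coef ((D q *\<^sub>v y' {}) $ c) 0 = 0"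
      using l differential_carrier[of q] by simp
  qed
  then obtain v u where
    v: "\<And>T. T \<subseteq> {..<n} \<Longrightarrow> v T \<in> free_module n ?r" and
    u: "\<And>T. T \<subseteq> {..<n} \<Longrightarrow> u T \<in> free_module n (length (d (Suc q)))" and
    eq: "\<And>T. T \<subseteq> {..<n} \<Longrightarrow> y' T = koszul_differential q v T + D (Suc q) *\<^sub>v u T"
    by blast
  have uc: "u T \<in> carrier_vec (length (d (Suc q)))" if "T \<subseteq> {..<n}" for T
    using u[OF that] by (simp add: free_module_def)
  have "D (Suc q) *\<^sub>v y T = D (Suc q) *\<^sub>v koszul_differential (Suc q) u T"
    if T: "T \<subseteq> {..<n}" for T
  proof -
    have "D (Suc q) *\<^sub>v koszul_differential (Suc q) u T =
        koszul_differential q (\<lambda>U. D (Suc q) *\<^sub>v u U) T"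
      by (rule coordinatewise_koszul_mult_mat_vec[OF DS uc T, symmetric])
    also have "\<dots> = koszul_differential q (\<lambda>U. y' U - koszul_differential q v U) T"
    proof (rule coordinatewise_koszul_cong[OF _ T])
      fix U :: "nat set" assume "U \<subseteq> {..<n}"
      then show "D (Suc q) *\<^sub>v u U = y' U - koszul_differential q v U"
        using DS unfolding eq[OF \<open>U \<subseteq> {..<n}\<close>] by (intro eq_vecI) simp_all
    qed
    also have "\<dots> = koszul_differential q y' T - koszul_differential q (koszul_differential q v) T"
      by (rule coordinatewise_koszul_diff[OF koszul_chainD(1)[OF y'] _ T]) simp_all
    also have "\<dots> = D (Suc q) *\<^sub>v y T"
      using DS yc[OF T] by (simp add: coordinatewise_koszul_koszul[OF T] dy'[OF T] z_def)
    finally show ?thesis ..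
  qed
  from split_of_boundary_lift[OF koszul_chain_free_module[OF y] u this] u
  show ?case by blast
qed

end

lemma const_coeff_mult:
  assumes "coef f 0 = 0"
  shows "coef (f * g) (0 :: nat \<Rightarrow>\<^sub>0 nat) = (0 :: 'k::field)"
proof (rule ccontr)
  assume "coef (f * g) 0 \<noteq> 0"
  then have "0 \<in> supp (f * g)" by (simp add: in_keys_iff)
  then obtain a b where ab: "0 = a + b" "a \<in> supp f" using keys_mult[of f g] by blast
  have "coef a x + coef b x = 0" for x using ab(1) by (simp flip: lookup_add)
  then have "a = 0" by (intro poly_mapping_eqI) simp
  with ab assms show False by (simp add: in_keys_iff)
qed

text \<open>A basis element of \<open>F\<^sub>i\<close> of degree \<open>j\<close> is a chain in \<open>K\<^sub>0 \<otimes> F\<^sub>i\<close> to which the decomposition applies: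
  by minimality its image under the differential has no constant term. Hence it is \<open>\<partial> v + D u\<close>. But
  Koszul boundaries have no constant term, nor has the image of the next differential, again by
  minimality, whereas the basis element has the coordinate \<open>1\<close>.\<close>

theorem degree_not_in_minimal_resolution:
  fixes I :: "'k::field mpoly set"
  assumes min: "minimal_graded_free_resolution n I d D"
    and vanish: "koszul_homology_vanishes n I i j"
  shows "j \<notin> set (d i)"
proof
  assume "j \<in> set (d i)"
  then obtain c where c: "c < length (d i)" "d i ! c = j" by (auto simp: in_set_conv_nth)
  interpret graded_resolution n I d D
    using min by unfold_locales (simp add: minimal_graded_free_resolution_def)
  have const: "coef (D (Suc l) $$ (a, b)) 0 = 0"
    if "a < length (d l)" "b < length (d (Suc l))" for l a b
  proof -
    have "D (Suc l) $$ (a, b) \<in> elements_mat (D (Suc l))"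
      using differential_carrier[of "Suc l"] that by (intro elements_matI) auto
    then show ?thesis using min by (auto simp: minimal_graded_free_resolution_def)
  qed
  have const': "coef ((D (Suc l) *\<^sub>v v) $ a) 0 = 0"
    if "a < length (d l)" "v \<in> carrier_vec (length (d (Suc l)))" for l a v
    using differential_carrier[of "Suc l"] that
    by (subst mult_mat_vec_index_sum[of _ "length (d l)" "length (d (Suc l))"])
      (auto simp: lookup_sum const_coeff_mult const)
  let ?r = "length (d i)"
  define y :: "nat set \<Rightarrow> 'k mpoly vec"
    where "y T = (if T = {} then unit_vec ?r c else 0\<^sub>v ?r)" for T
  have y: "koszul_chain n 0 (d i) j y"
    unfolding koszul_chain_def
  proof (intro allI impI conjI)
    fix T :: "nat set" assume "T \<subseteq> {..<n}"
    then have fin: "finite T" using finite_subset by blast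
    show "y T \<in> carrier_vec ?r" by (simp add: y_def)
    show "y T = 0\<^sub>v ?r" if "card T \<noteq> 0" using that by (auto simp: y_def)
    show "homogeneous n (j - int 0 - d i ! b) (y T $ b)" if "b < ?r" for b
      using that c by (auto simp: y_def homogeneous_zero) 
        (simp add: homogeneous_def polys_one total_degree_def)
  qed
  have dy: "koszul_differential i y U = 0\<^sub>v ?r" for U
    by (rule eq_vecI) (simp_all add: koszul_def y_def)
  obtain v u where vu: "\<And>T. T \<subseteq> {..<n} \<Longrightarrow> v T \<in> free_module n ?r"
      "\<And>T. T \<subseteq> {..<n} \<Longrightarrow> u T \<in> free_module n (length (d (Suc i)))"
      "\<And>T. T \<subseteq> {..<n} \<Longrightarrow> y T = koszul_differential i v T + D (Suc i) *\<^sub>v u T"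
  proof -
    have "\<exists>v u. \<forall>T\<subseteq>{..<n}. v T \<in> free_module n ?r \<and> u T \<in> free_module n (length (d (Suc i))) \<and>
      y T = koszul_differential i v T + D (Suc i) *\<^sub>v u T"
    proof (rule koszul_chain_decomposition[OF vanish y])
      show "D i *\<^sub>v koszul_differential i y U = 0\<^sub>v (length (target i))" for U
        using differential_carrier[of i] unfolding dy by (intro eq_vecI) auto
      show "coef ((D i *\<^sub>v y {}) $ b) 0 = 0" if "i = Suc l" "b < length (d l)" for l b
        using const'[OF that(2)] that(1) koszul_chainD(1)[OF y, of "{}"] by simp
    qed simp
    then show thesis using that by blast
  qed
  have "coef (y {} $ c) 0 =
      coef (koszul_differential i v {} $ c) 0 + coef ((D (Suc i) *\<^sub>v u {}) $ c) 0"
    using c(1) differential_carrier[of "Suc i"] vu(3)[of "{}"]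
    by (simp add: lookup_add del: index_mult_mat_vec)
  also have "\<dots> = 0"
    using c(1) vu(2)[of "{}"] by (simp add: koszul_const_coeff const' free_module_def del: index_mult_mat_vec)
  finally show False using c(1) by (simp add: y_def)
qed

section \<open>Regularity\<close>

text \<open>A cycle \<open>\<omega>\<close> is the boundary of its cone, and the degree bound keeps the cone in the ideal. The
  bound also makes the coefficient degree \<open>j - i\<close> positive, so that \<open>\<omega>\<close> has no constant term, as the
  homotopy requires.\<close>

lemma koszul_homology_vanishes_stanley_reisner:
  assumes down: "\<And>F G. F \<in> \<Delta> \<Longrightarrow> G \<subseteq> F \<Longrightarrow> G \<in> \<Delta>"
    and card: "\<And>F. F \<in> \<Delta> \<Longrightarrow> card F \<le> D"
    and j: "int D + 2 \<le> j - int i"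
  shows "koszul_homology_vanishes n (stanley_reisner_ideal n \<Delta> :: 'k::field mpoly set) i j"
proof -
  have sr: "stanley_reisner_ideal n \<Delta> = (nonface_polys n \<Delta> :: 'k mpoly set)"
    by (rule stanley_reisner_ideal_eq_nonface_polys) (rule down)
  show ?thesis
    unfolding koszul_homology_vanishes_def sr
  proof (intro allI impI)
    fix \<omega> :: "nat set \<Rightarrow> 'k mpoly"
    assume *: "\<forall>U\<subseteq>{..<n}. \<omega> U \<in> nonface_polys n \<Delta> \<and> homogeneous n (j - int i) (\<omega> U) \<and>
      (card U \<noteq> i \<longrightarrow> \<omega> U = 0) \<and> koszul n \<omega> U = 0"
    have mem: "\<omega> U \<in> nonface_polys n \<Delta>" if "U \<subseteq> {..<n}" for U using * that by blast
    have hom: "homogeneous n (j - int i) (\<omega> U)" if "U \<subseteq> {..<n}" for U using * that by blast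
    have "(0 :: nat \<Rightarrow>\<^sub>0 nat) \<notin> supp (\<omega> {})"
    proof
      assume "0 \<in> supp (\<omega> {})"
      with hom[of "{}"] have "int (total_degree 0) = j - int i" unfolding homogeneous_def by blast
      with j show False by (simp add: total_degree_def)
    qed
    then have const: "coef (\<omega> {}) 0 = 0" by (simp add: in_keys_iff)
    have "cone \<omega> T \<in> nonface_polys n \<Delta> \<and> koszul n (cone \<omega>) T = \<omega> T" if T: "T \<subseteq> {..<n}" for T
    proof
      show "cone \<omega> T \<in> nonface_polys n \<Delta>"
        by (rule cone_nonface_polys[OF card j mem hom T])
      show "koszul n (cone \<omega>) T = \<omega> T"
        using T
      proof (rule koszul_cone_cycle)
        show "\<omega> U \<in> polys n" if "U \<subseteq> {..<n}" for U using hom[OF that] by (simp add: homogeneous_def)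
      qed (use * const in auto)
    qed
    then show "\<exists>\<eta>. \<forall>U\<subseteq>{..<n}. \<eta> U \<in> nonface_polys n \<Delta> \<and> koszul n \<eta> U = \<omega> U" by blast
  qed
qed

theorem regularity_stanley_reisner_ideal_le:
  assumes "\<And>F G. F \<in> \<Delta> \<Longrightarrow> G \<subseteq> F \<Longrightarrow> G \<in> \<Delta>" and "\<And>F. F \<in> \<Delta> \<Longrightarrow> card F \<le> D"
  shows "regularity n (stanley_reisner_ideal n \<Delta> :: 'k::field mpoly set) \<le> ereal (real D + 1)"
  unfolding regularity_def
proof (rule Sup_least, safe)
  fix i :: nat and j :: int and d and M :: "nat \<Rightarrow> 'k mpoly mat"
  assume M: "minimal_graded_free_resolution n (stanley_reisner_ideal n \<Delta>) d M" "j \<in> set (d i)"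
  have "\<not> int D + 2 \<le> j - int i"
  proof
    assume "int D + 2 \<le> j - int i"
    with assms have "koszul_homology_vanishes n (stanley_reisner_ideal n \<Delta> :: 'k mpoly set) i j"
      by (rule koszul_homology_vanishes_stanley_reisner)
    with degree_not_in_minimal_resolution[OF M(1)] M(2) show False by blast
  qed
  then show "ereal (real_of_int j - real i) \<le> ereal (real D + 1)" by simp
qed

lemma subword_complex_subset:
  assumes "F \<in> subword_complex W S Q w" "G \<subseteq> F"
  shows "G \<in> subword_complex W S Q w"
proof -
  obtain P where P: "P \<subseteq> {..<length Q}" "contains W S Q P w" "F = {..<length Q} - P"
    using assms(1) by (auto simp: subword_complex_def)
  then have "P \<subseteq> {..<length Q} - G" "G = {..<length Q} - ({..<length Q} - G)"
    using assms(2) by blast+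
  moreover from this(1) P(2) have "contains W S Q ({..<length Q} - G) w"
    unfolding contains_def by blast
  ultimately show ?thesis unfolding subword_complex_def by blast
qed

lemma contains_card_ge:
  assumes "contains W S Q P w" "P \<subseteq> {..<length Q}"
  shows "coxeter_length W S w \<le> card P"
proof -
  obtain P' where P': "P' \<subseteq> P" "length (nths Q P') = coxeter_length W S w"
    using assms(1) by (auto simp: contains_def represents_def reduced_expression_def)
  have "{i. i < length Q \<and> i \<in> P'} = P'" using P'(1) assms(2) by auto
  then have "card P' = coxeter_length W S w" using P'(2) by (simp add: length_nths)
  moreover have "card P' \<le> card P"
    using P'(1) assms(2) by (intro card_mono) (auto intro: finite_subset)
  ultimately show ?thesis by simp
qed

lemma subword_complex_card_le:
  assumes "F \<in> subword_complex W S Q w"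
  shows "card F \<le> length Q - coxeter_length W S w"
proof -
  obtain P where P: "P \<subseteq> {..<length Q}" "contains W S Q P w" "F = {..<length Q} - P"
    using assms by (auto simp: subword_complex_def)
  have "card F = length Q - card P"
    using P(1) unfolding P(3) by (subst card_Diff_subset) (auto intro: finite_subset)
  with contains_card_ge[OF P(2,1)] show ?thesis by simp
qed

theorem corollary1p15:
  fixes W :: "('a, 'b) monoid_scheme" and S :: "'a set" and Q :: "'a list" and \<pi> :: 'a and n :: nat
  assumes "coxeter_system W S"
    and "Q \<in> lists S" and "length Q = n"
    and "\<pi> \<in> carrier W" and "contains W S Q {..<n} \<pi>"
  shows "regularity n (stanley_reisner_ideal n (subword_complex W S Q \<pi>) :: 'k::field mpoly set)
    \<le> ereal (real n - real (coxeter_length W S \<pi>) + 1)"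
proof -
  have "regularity n (stanley_reisner_ideal n (subword_complex W S Q \<pi>) :: 'k mpoly set)
      \<le> ereal (real (n - coxeter_length W S \<pi>) + 1)"
    using subword_complex_subset subword_complex_card_le[of _ W S Q \<pi>, unfolded assms(3)]
    by (rule regularity_stanley_reisner_ideal_le)
  moreover have "coxeter_length W S \<pi> \<le> n"
    using contains_card_ge[OF assms(5)] assms(3) by simp
  ultimately show ?thesis by (simp add: of_nat_diff)
qed

end
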